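(* Let $L,M,a,b$ be integers such that either $a,b\geq 0$ or $a,b\leq 0$. Then $$\sum_{i=|b|}^{\min\{L-|a|,M\}} q^{\frac{1}{2}i^2}\begin{bmatrix}L+M-i\\ L\end{bmatrix}\mathcal{T}(L-i,i,a,b)=q^{\frac{1}{2}b^2}\,\mathcal{T}(L,M,a+b,b).$$
   Context: Here $q$ is a formal variable (with a fixed square root $q^{1/2}$; the identity is one of polynomials in $q^{1/2}$). For $n\ge 1$ put $(q)_n=\prod_{j=1}^{n}(1-q^j)$, and $(q)_0=1$. The $q$-binomial coefficient is defined for integers $n,a$ by $$\begin{bmatrix}n\\ a\end{bmatrix}=\begin{cases}\dfrac{(q)_n}{(q)_a(q)_{n-a}} & \text{if } 0\le a\le n,\\[2mm] 0 & \text{otherwise.}\end{cases}$$ For integers $L,M,a,b$ the refined $q$-trinomial coefficient is the polynomial $$\mathcal{T}(L,M,a,b)=\sum_{\substack{n=0\\ n+a+L\text{ even}}}^{\min\{L-|a|,M\}}q^{\frac12 n^2}\begin{bmatrix}M\\ n\end{bmatrix}\begin{bmatrix}M+b+(L-a-n)/2\\ M+b\end{bmatrix}\begin{bmatrix}M-b+(L+a-n)/2\\ M-b\end{bmatrix}.$$ Sums whose upper limit is smaller than their lower limit are empty and equal to $0$. *)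

theory Defs
  imports "HOL-Computational_Algebra.Polynomial"
begin

text \<open>
  All identities live in the polynomial ring over the integers in one variable, and that variable is
  the fixed square root of \<open>q\<close>. Hence \<open>q\<close> is its square, and \<open>q\<close> to the power \<open>n\<^sup>2 / 2\<close> is
  \<open>q_half ^ n\<^sup>2\<close>.
\<close>

definition q_half :: "int poly" where
  "q_half = [:0, 1:]"

definition q :: "int poly" where
  "q = q_half ^ 2"

definition q_poch :: "nat \<Rightarrow> int poly" where
  "q_poch n = (\<Prod>j = 1..n. 1 - q ^ j)"

text \<open>
  The operation \<open>div\<close> on integer polynomials is the quotient whenever the division is exact; it is
  exact here by \<open>q_binom_mult\<close> below.
\<close>

definition q_binom :: "int \<Rightarrow> int \<Rightarrow> int poly" where
  "q_binom n a =
     (if 0 \<le> a \<and> a \<le> n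
      then q_poch (nat n) div (q_poch (nat a) * q_poch (nat (n - a)))
      else 0)"

text \<open>The parity condition makes both divisions by 2 exact.\<close>

definition q_trinom :: "int \<Rightarrow> int \<Rightarrow> int \<Rightarrow> int \<Rightarrow> int poly" where
  "q_trinom L M a b =
     (\<Sum>n \<in> {n \<in> {0..min (L - \<bar>a\<bar>) M}. even (n + a + L)}.
        q_half ^ nat (n\<^sup>2) * q_binom M n
        * q_binom (M + b + (L - a - n) div 2) (M + b)
        * q_binom (M - b + (L + a - n) div 2) (M - b))"

lemma q_poch_Suc: "q_poch (Suc n) = q_poch n * (1 - q ^ Suc n)"
  by (simp add: q_poch_def mult.commute)

lemma q_poch_nonzero: "q_poch n \<noteq> 0"
proof -
  have "poly (q_poch n) 2 = (\<Prod>j = 1..n. 1 - 4 ^ j)"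
    by (simp add: q_poch_def q_def q_half_def poly_prod poly_power)
  also have "\<dots> \<noteq> (0::int)"
  proof -
    have "(4::int) ^ j \<noteq> 1" if "1 \<le> j" for j :: nat
      using one_less_power[of "4::int" j] that by linarith
    then show ?thesis by auto
  qed
  finally show ?thesis
    by auto
qed

lemma q_poch_mult_dvd: "q_poch a * q_poch b dvd q_poch (a + b)"
proof (induction "a + b" arbitrary: a b)
  case 0
  then show ?case by (simp add: q_poch_def)
next
  case (Suc n)
  show ?case
  proof (cases "a = 0 \<or> b = 0")
    case True
    then show ?thesis by (auto simp: q_poch_def)
  next
    case False
    then obtain c d where cd: "a = Suc c" "b = Suc d"
      by (metis not0_implies_Suc)
    have "q_poch c * q_poch b dvd q_poch n" "q_poch a * q_poch d dvd q_poch n"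
      using Suc.hyps(1)[of c b] Suc.hyps(1)[of a d] Suc.hyps(2) cd by auto
    then have "q_poch c * q_poch b * (1 - q ^ Suc c) dvd q_poch n * (1 - q ^ Suc c)"
      "q_poch a * q_poch d * (1 - q ^ Suc d) dvd q_poch n * (1 - q ^ Suc d)"
      by (auto intro: mult_dvd_mono simp del: power_Suc)
    then have *: "q_poch a * q_poch b dvd q_poch n * (1 - q ^ Suc c)"
      "q_poch a * q_poch b dvd q_poch n * (1 - q ^ Suc d)"
      unfolding cd q_poch_Suc by (simp_all only: ac_simps)
    have "q_poch (a + b) = q_poch n * (1 - q ^ Suc n)"
      using Suc.hyps(2) q_poch_Suc by metis
    also have "q ^ Suc n = q ^ Suc c * q ^ Suc d"
      using Suc.hyps(2) cd by (simp add: power_add)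
    also have "q_poch n * (1 - q ^ Suc c * q ^ Suc d) =
        q_poch n * (1 - q ^ Suc c) + q ^ Suc c * (q_poch n * (1 - q ^ Suc d))"
      by (simp add: algebra_simps)
    finally show ?thesis
      using * by (metis dvd_add dvd_mult)
  qed
qed

lemma q_binom_mult:
  assumes "0 \<le> a" "a \<le> n"
  shows "q_binom n a * (q_poch (nat a) * q_poch (nat (n - a))) = q_poch (nat n)"
proof -
  have "nat n = nat a + nat (n - a)"
    using assms by simp
  then show ?thesis
    using assms q_poch_mult_dvd[of "nat a" "nat (n - a)"] by (simp add: q_binom_def)
qed

end

theory Submission
  imports Defs
begin

text \<open>
  For \<open>M \<ge> \<bar>b\<bar>\<close> the polynomial \<open>T(L,M,a,b)\<close> is the
  coefficient of \<open>t^L u^a\<close> in \<open>(-q^(1/2) t)_M / ((t/u)_(M+b+1) (t u)_(M-b+1))\<close>. Multiplying by single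
  factors of these products gives Pascal-type recurrences in each of the three indices \<open>M\<close>, \<open>M + b\<close>
  and \<open>M - b\<close>. Multiplying the sum over \<open>i\<close> by \<open>q^M\<close> and lowering \<open>L\<close> amounts to
  multiplying the \<open>i\<close>-th summand by \<open>q^i\<close> and taking a difference in \<open>i\<close>, so recurrences of
  \<open>T\<close> carry over to the left-hand side of the theorem. For \<open>b = 0\<close> both sides satisfy one recurrence
  in \<open>L\<close> and \<open>M\<close>, for all \<open>a\<close>. From \<open>b\<close> to \<open>b + 1\<close> both sides satisfy
  a recurrence that expresses the values at \<open>(L, a - 1, b + 1)\<close> through those at
  \<open>(L - 1, a, b + 1)\<close>, \<open>(L, a, b)\<close> and \<open>(L - 1, a - 1, b)\<close>. It holds for
  \<open>a > 0\<close> only, hence the restriction to \<open>a, b \<ge> 0\<close>. The case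
  \<open>a, b \<le> 0\<close> follows by the symmetry \<open>T(L,M,-a,-b) = T(L,M,a,b)\<close>.
\<close>

section \<open>q-binomials in symmetric form and their Pascal rules\<close>

text \<open>The coefficient of \<open>t^k\<close> in \<open>1/(t;q)_(N+1)\<close>. This indexing
  makes \<open>N\<close> and \<open>k\<close> interchangeable.\<close>

definition q_mchoose :: "int \<Rightarrow> int \<Rightarrow> int poly" where
  "q_mchoose N k = q_binom (N + k) N"

lemma q_mchoose_neg [simp]: "N < 0 \<or> k < 0 \<Longrightarrow> q_mchoose N k = 0"
  by (auto simp: q_mchoose_def q_binom_def)

lemma q_mchoose_mult:
  "q_mchoose (int m) (int k) * (q_poch m * q_poch k) = q_poch (m + k)"
  using q_binom_mult[of "int m" "int m + int k"] by (simp add: q_mchoose_def nat_add_distrib)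

lemma q_mchoose_eqI:
  assumes "x * (q_poch m * q_poch k) = q_poch (m + k)"
  shows "q_mchoose (int m) (int k) = x"
  using assms q_mchoose_mult[of m k] q_poch_nonzero by (metis mult_cancel_right mult_eq_0_iff)

lemma q_mchoose_commute: "q_mchoose N k = q_mchoose k N"
proof (cases "N < 0 \<or> k < 0")
  case False
  then obtain m j where mj: "N = int m" "k = int j"
    by (metis not_less zero_le_imp_eq_int)
  show ?thesis
    unfolding mj by (rule q_mchoose_eqI) (use q_mchoose_mult[of j m] in \<open>simp add: ac_simps\<close>)
qed auto

lemma q_mchoose_0 [simp]: "0 \<le> k \<Longrightarrow> q_mchoose 0 k = 1"
  using q_mchoose_eqI[of 1 0 "nat k"] by (simp add: q_poch_def)

lemma q_mchoose_0_right [simp]: "0 \<le> N \<Longrightarrow> q_mchoose N 0 = 1"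
  using q_mchoose_commute q_mchoose_0 by metis

text \<open>Multiplication of \<open>1/(t;q)_(N+1)\<close> by its last factor
  \<open>1 - q^N t\<close>. For \<open>N = 0\<close> the product is the constant 1, which
  \<open>q_mchoose (- 1) k = 0\<close> misses at \<open>k = 0\<close>.\<close>

lemma q_mchoose_pascal:
  assumes "N \<noteq> 0 \<or> k \<noteq> 0"
  shows "q_mchoose N k = q ^ nat N * q_mchoose N (k - 1) + q_mchoose (N - 1) k"
proof -
  consider "N < 0 \<or> k < 0" | "N = 0" "k > 0" | "N > 0" "k = 0" | "N > 0" "k > 0"
    using assms by linarith
  then show ?thesis
  proof cases
    case 4
    define m j where "m = nat (N - 1)" and "j = nat (k - 1)"
    have N: "N = int (Suc m)" and k: "k = int (Suc j)"
      using 4 by (auto simp: m_def j_def)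
    have 1: "q_mchoose N (k - 1) * (q_poch (Suc m) * q_poch j) = q_poch (Suc (m + j))"
      using q_mchoose_mult[of "Suc m" j] by (simp add: N k)
    have 2: "q_mchoose (N - 1) k * (q_poch m * q_poch (Suc j)) = q_poch (Suc (m + j))"
      using q_mchoose_mult[of m "Suc j"] by (simp add: N k)
    have "(q ^ nat N * q_mchoose N (k - 1) + q_mchoose (N - 1) k)
        * (q_poch (Suc m) * q_poch (Suc j))
      = q ^ Suc m * (1 - q ^ Suc j) * (q_mchoose N (k - 1) * (q_poch (Suc m) * q_poch j))
        + (1 - q ^ Suc m) * (q_mchoose (N - 1) k * (q_poch m * q_poch (Suc j)))"
      by (simp add: N q_poch_Suc algebra_simps del: power_Suc of_nat_Suc)
    also have "\<dots> = q_poch (Suc (m + j)) * (1 - q ^ Suc (Suc (m + j)))"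
      unfolding 1 2 by (simp add: algebra_simps power_add)
    also have "\<dots> = q_poch (Suc m + Suc j)"
      using q_poch_Suc[of "Suc (m + j)"] by simp
    finally show ?thesis
      using q_mchoose_eqI N k by metis
  qed auto
qed

lemma q_mchoose_pascal':
  assumes "N \<noteq> 0 \<or> k \<noteq> 0"
  shows "q_mchoose N k = q_mchoose N (k - 1) + q ^ nat k * q_mchoose (N - 1) k"
  using q_mchoose_pascal[of k N] assms
  by (auto simp: q_mchoose_commute[of N] q_mchoose_commute[of "N - 1"])

section \<open>Trinomials with independent indices and their one-factor recurrences\<close>

text \<open>For \<open>n\<close> of the right parity this is, by the q-binomial theorem, the
  coefficient of \<open>t^n\<close> in the numerator \<open>(-q^(1/2) t)_M\<close>. With the parity
  condition inside the weight, all sums can run from 0 to \<open>M\<close>.\<close>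

definition trinom_weight :: "int \<Rightarrow> int \<Rightarrow> nat \<Rightarrow> nat \<Rightarrow> int poly" where
  "trinom_weight L a M n =
     (if even (int n + a + L) then q_half ^ n\<^sup>2 * q_binom (int M) (int n) else 0)"

lemma trinom_weight_shift [simp]:
  "trinom_weight (L - 1) (a + 1) M n = trinom_weight L a M n"
  "trinom_weight (L - 1) (a - 1) M n = trinom_weight L a M n"
  "trinom_weight L (- a) M n = trinom_weight L a M n"
  by (auto simp: trinom_weight_def)

text \<open>The last two indices stand for \<open>M + b\<close> and \<open>M - b\<close>, so that each can be lowered separately.\<close>

definition gen_trinom :: "int \<Rightarrow> int \<Rightarrow> nat \<Rightarrow> int \<Rightarrow> int \<Rightarrow> int poly" where
  "gen_trinom L a M N K =
     (\<Sum>n\<le>M. trinom_weight L a M n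
        * q_mchoose N ((L - a - int n) div 2) * q_mchoose K ((L + a - int n) div 2))"

lemma gen_trinom_commute: "gen_trinom L (- a) M N K = gen_trinom L a M K N"
  unfolding gen_trinom_def by (intro sum.cong) (auto simp: ac_simps)

lemma gen_trinom_neg [simp]: "N < 0 \<or> K < 0 \<Longrightarrow> gen_trinom L a M N K = 0"
  unfolding gen_trinom_def by (intro sum.neutral) auto

lemma gen_trinom_neg_L [simp]: "L < 0 \<Longrightarrow> gen_trinom L a M N K = 0"
proof -
  assume "L < 0"
  then have "(L - a - int n) div 2 < 0 \<or> (L + a - int n) div 2 < 0" for n
    by linarith
  then show ?thesis
    unfolding gen_trinom_def by (intro sum.neutral) (metis mult_zero_left mult_zero_right q_mchoose_neg)
qed

text \<open>Multiplication of the generating function by the last factor \<open>1 - q^N t/u\<close>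
  of its first denominator; the monomial \<open>t/u\<close> moves \<open>(L, a)\<close> to
  \<open>(L - 1, a + 1)\<close>.\<close>

lemma gen_trinom_pascal_left:
  assumes "N \<noteq> 0"
  shows "gen_trinom L a M N K
    = q ^ nat N * gen_trinom (L - 1) (a + 1) M N K + gen_trinom L a M (N - 1) K"
proof -
  have x: "(L - 1 - (a + 1) - int n) div 2 = (L - a - int n) div 2 - 1"
    "L - 1 + (a + 1) - int n = L + a - int n" for n
    by (simp_all add: algebra_simps)
  have "w * q_mchoose N k * v
     = q ^ nat N * (w * q_mchoose N (k - 1) * v) + w * q_mchoose (N - 1) k * v" for w v k
    unfolding q_mchoose_pascal[of N k, OF disjI1, OF assms] by (simp add: algebra_simps)
  then show ?thesis
    unfolding gen_trinom_def sum_distrib_left sum.distrib[symmetric] x trinom_weight_shift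
    by (intro sum.cong refl)
qed

text \<open>
  For \<open>K = 0\<close> the recurrence for the last factor fails only where that factor has index \<open>0\<close>;
  if \<open>a > 0\<close> the other factor then has a negative index and vanishes.
\<close>

lemma gen_trinom_pascal_right:
  assumes "K \<noteq> 0 \<or> a > 0"
  shows "gen_trinom L a M N K
    = q ^ nat K * gen_trinom (L - 1) (a - 1) M N K + gen_trinom L a M N (K - 1)"
proof -
  have x: "(L - 1 + (a - 1) - int n) div 2 = (L + a - int n) div 2 - 1"
    "L - 1 - (a - 1) - int n = L - a - int n" for n
    by (simp_all add: algebra_simps)
  have "trinom_weight L a M n * q_mchoose N ((L - a - int n) div 2) * q_mchoose K ((L + a - int n) div 2)
     = q ^ nat K * (trinom_weight L a M n * q_mchoose N ((L - a - int n) div 2)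
         * q_mchoose K ((L + a - int n) div 2 - 1))
       + trinom_weight L a M n * q_mchoose N ((L - a - int n) div 2)
         * q_mchoose (K - 1) ((L + a - int n) div 2)" for n
  proof (cases "(K \<noteq> 0 \<or> (L + a - int n) div 2 \<noteq> 0) \<or> odd (int n + a + L)")
    case True
    then show ?thesis
    proof
      assume "K \<noteq> 0 \<or> (L + a - int n) div 2 \<noteq> 0"
      then show ?thesis
        unfolding q_mchoose_pascal[OF \<open>K \<noteq> 0 \<or> (L + a - int n) div 2 \<noteq> 0\<close>]
        by (simp add: algebra_simps)
    qed (simp add: trinom_weight_def)
  next
    case False
    then have "(L - a - int n) div 2 < 0" using assms by presburger
    then show ?thesis by simp
  qed
  then show ?thesis
    unfolding gen_trinom_def sum_distrib_left sum.distrib[symmetric] x trinom_weight_shift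
    by (intro sum.cong refl)
qed

lemma q_binom_pascal:
  assumes "n \<le> Suc M"
  shows "q_binom (int (Suc M)) (int n)
    = q_binom (int M) (int n) + q ^ (Suc M - n) * q_binom (int M) (int n - 1)"
proof -
  have "nat (1 + int M - int n) = Suc M - n" "int n \<noteq> 0 \<or> int (Suc M) - int n \<noteq> 0"
    by auto
  then show ?thesis
    using q_mchoose_pascal'[of "int n" "int (Suc M) - int n"]
    by (auto simp: q_mchoose_def algebra_simps)
qed

text \<open>The numerator gains the factor \<open>1 + q^(M+1/2) t\<close>. Termwise this is the
  Pascal rule for the weight, followed by a shift of \<open>n\<close>.\<close>

lemma gen_trinom_Suc:
  "gen_trinom L a (Suc M) N K = gen_trinom L a M N K + q_half ^ (2 * M + 1) * gen_trinom (L - 1) a M N K"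
proof -
  define w where "w n = (if even (int n + a + L) then q_mchoose N ((L - a - int n) div 2)
    * q_mchoose K ((L + a - int n) div 2) else 0)" for n
  have 1: "gen_trinom L a M' N K = (\<Sum>n\<le>M'. q_half ^ n\<^sup>2 * q_binom (int M') (int n) * w n)" for M'
    unfolding gen_trinom_def trinom_weight_def w_def by (intro sum.cong) auto
  have 2: "gen_trinom (L - 1) a M N K
      = (\<Sum>n\<le>M. q_half ^ n\<^sup>2 * q_binom (int M) (int n) * w (Suc n))"
    unfolding gen_trinom_def trinom_weight_def w_def
    by (intro sum.cong) (auto simp: algebra_simps)
  have "gen_trinom L a (Suc M) N K = (\<Sum>n\<le>Suc M. q_half ^ n\<^sup>2 * q_binom (int M) (int n) * w n)
      + (\<Sum>n\<le>Suc M. q_half ^ n\<^sup>2 * q ^ (Suc M - n) * q_binom (int M) (int n - 1) * w n)"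
    unfolding 1 sum.distrib[symmetric]
    by (intro sum.cong refl) (simp add: q_binom_pascal algebra_simps del: of_nat_Suc)
  also have "(\<Sum>n\<le>Suc M. q_half ^ n\<^sup>2 * q_binom (int M) (int n) * w n) = gen_trinom L a M N K"
    unfolding 1 by (simp add: q_binom_def)
  also have "(\<Sum>n\<le>Suc M. q_half ^ n\<^sup>2 * q ^ (Suc M - n) * q_binom (int M) (int n - 1) * w n)
      = (\<Sum>n\<le>M. q_half ^ (Suc n)\<^sup>2 * q ^ (M - n) * q_binom (int M) (int n) * w (Suc n))"
    by (subst sum.atMost_Suc_shift) (simp add: q_binom_def[of _ "- 1"])
  also have "\<dots> = q_half ^ (2 * M + 1) * gen_trinom (L - 1) a M N K"
    unfolding 2 sum_distrib_left
  proof (intro sum.cong refl)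
    fix n assume "n \<in> {..M}"
    then obtain d where M: "M = n + d" by (auto simp: le_iff_add)
    \<comment> \<open>The power \<open>q ^ (M - n)\<close> from the Pascal rule offsets the growth
      of the square, so that the extra factor is the same for all \<open>n\<close>.\<close>
    have "(Suc n)\<^sup>2 + 2 * (M - n) = 2 * M + 1 + n\<^sup>2"
      by (simp add: M power2_eq_square)
    then have "q_half ^ (Suc n)\<^sup>2 * q ^ (M - n) = q_half ^ (2 * M + 1) * q_half ^ n\<^sup>2"
      unfolding q_def power_mult[symmetric] power_add[symmetric] by simp
    then show "q_half ^ (Suc n)\<^sup>2 * q ^ (M - n) * q_binom (int M) (int n) * w (Suc n)
      = q_half ^ (2 * M + 1) * (q_half ^ n\<^sup>2 * q_binom (int M) (int n) * w (Suc n))"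
      by (simp add: mult.assoc)
  qed
  finally show ?thesis .
qed

section \<open>The link with \<open>q_trinom\<close>\<close>

definition trinom :: "int \<Rightarrow> nat \<Rightarrow> int \<Rightarrow> int \<Rightarrow> int poly" where
  "trinom L M a b = gen_trinom L a M (int M + b) (int M - b)"

lemma trinom_eq: "q_trinom L (int M) a b = trinom L M a b"
proof -
  let ?f = "\<lambda>n. q_half ^ nat (n\<^sup>2) * q_binom M n
        * q_binom (M + b + (L - a - n) div 2) (M + b)
        * q_binom (M - b + (L + a - n) div 2) (M - b)"
  have "q_trinom L (int M) a b = (\<Sum>n \<in> {n \<in> {0..int M}. even (n + a + L)}. ?f n)"
    unfolding q_trinom_def
  proof (intro sum.mono_neutral_left ballI)
    show "finite {n \<in> {0..int M}. even (n + a + L)}"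
      by (rule finite_subset[of _ "{0..int M}"]) auto
  next
    fix n assume n: "n \<in> {n \<in> {0..int M}. even (n + a + L)}
      - {n \<in> {0..min (L - \<bar>a\<bar>) (int M)}. even (n + a + L)}"
    \<comment> \<open>Beyond \<open>L - \<bar>a\<bar>\<close> one of the last two q-binomials has
      its upper index below its lower one, so extending the range adds only zeros.\<close>
    then have "(L - a - n) div 2 < 0 \<or> (L + a - n) div 2 < 0"
      by auto
    then show "?f n = 0"
      unfolding q_binom_def by auto
  qed auto
  also have "\<dots> = (\<Sum>n \<in> {0..int M}. if even (n + a + L) then ?f n else 0)"
    by (rule sum.inter_filter) simp
  also have "\<dots> = (\<Sum>n \<in> int ` {..M}. if even (n + a + L) then ?f n else 0)"
    by (simp add: atMost_atLeast0 image_int_atLeastAtMost)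
  also have "\<dots> = trinom L M a b"
    unfolding trinom_def gen_trinom_def trinom_weight_def
    by (subst sum.reindex) (auto simp: q_mchoose_def nat_power_eq intro!: sum.cong)
  finally show ?thesis .
qed

lemma trinom_neg [simp]: "L < 0 \<or> int M < \<bar>b\<bar> \<Longrightarrow> trinom L M a b = 0"
  unfolding trinom_def by (auto simp: abs_if split: if_splits)

lemma trinom_uminus: "trinom L M (- a) (- b) = trinom L M a b"
  using gen_trinom_commute[of L a] by (simp add: trinom_def)

section \<open>The sum over \<open>i\<close> as a convolution\<close>

text \<open>With \<open>F(x)\<close> the generating function of \<open>f\<close>, this is the
  coefficient of \<open>x^M\<close> in \<open>F(x)/(x;q)_(L+1)\<close> for \<open>L \<ge> 0\<close>;
  \<open>shift\<close> multiplies \<open>F\<close> by \<open>x\<close>.\<close>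

definition q_conv :: "int \<Rightarrow> nat \<Rightarrow> (nat \<Rightarrow> int poly) \<Rightarrow> int poly" where
  "q_conv L M f = (\<Sum>i\<le>M. q_mchoose L (int M - int i) * f i)"

definition shift :: "(nat \<Rightarrow> int poly) \<Rightarrow> nat \<Rightarrow> int poly" where
  "shift f i = (if i = 0 then 0 else f (i - 1))"

lemma shift_simps [simp]: "shift f 0 = 0" "shift f (Suc i) = f i"
  by (simp_all add: shift_def)

lemma q_conv_neg [simp]: "L < 0 \<Longrightarrow> q_conv L M f = 0"
  by (simp add: q_conv_def)

lemma q_conv_add: "q_conv L M f + q_conv L M g = q_conv L M (\<lambda>i. f i + g i)"
  by (simp add: q_conv_def sum.distrib algebra_simps)

lemma q_conv_diff: "q_conv L M f - q_conv L M g = q_conv L M (\<lambda>i. f i - g i)"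
  by (simp add: q_conv_def sum_subtractf algebra_simps)

lemma q_conv_mult: "c * q_conv L M f = q_conv L M (\<lambda>i. c * f i)"
  by (simp add: q_conv_def sum_distrib_left algebra_simps)

lemma q_conv_shift_Suc: "q_conv L (Suc M) (shift f) = q_conv L M f"
  unfolding q_conv_def by (subst sum.atMost_Suc_shift) simp

lemma q_conv_shift: "q_conv L M (shift f) = (\<Sum>i\<le>M. q_mchoose L (int M - int i - 1) * f i)"
proof (cases M)
  case (Suc N)
  show ?thesis
    unfolding Suc q_conv_shift_Suc by (simp add: q_conv_def algebra_simps)
qed (simp add: q_conv_def)

text \<open>For \<open>L > 0\<close>, replacing \<open>x\<close> by \<open>q x\<close> in
  \<open>F(x)/(x;q)_L\<close> gives \<open>(1 - x) F(q x)/(x;q)_(L+1)\<close>, and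
  \<open>1 - x\<close> is the difference in \<open>i\<close>. For \<open>L = 0\<close> the left side
  is zero and the right side is \<open>q ^ M * f M\<close>, hence the assumption.\<close>

lemma power_mult_q_conv:
  assumes "L = 0 \<Longrightarrow> f M = 0"
  shows "q ^ M * q_conv (L - 1) M f
    = q_conv L M (\<lambda>i. q ^ i * f i - shift (\<lambda>i. q ^ i * f i) i)"
proof -
  have "q ^ M * (q_mchoose (L - 1) (int M - int i) * f i)
     = q_mchoose L (int M - int i) * (q ^ i * f i) - q_mchoose L (int M - int i - 1) * (q ^ i * f i)"
    if "i \<le> M" for i
  proof (cases "L = 0 \<and> i = M")
    case True
    then show ?thesis using assms by simp
  next
    case False
    obtain d where M: "M = i + d" using le_Suc_ex[OF \<open>i \<le> M\<close>] by blast
    have "q_mchoose L (int M - int i)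
      = q_mchoose L (int M - int i - 1) + q ^ d * q_mchoose (L - 1) (int M - int i)"
      using q_mchoose_pascal'[of L "int M - int i"] False M by auto
    then show ?thesis
      by (simp add: M power_add algebra_simps)
  qed
  then show ?thesis
    unfolding q_conv_diff[symmetric] q_conv_shift
    by (simp add: q_conv_def sum_distrib_left sum_subtractf[symmetric])
qed

section \<open>The case \<open>b = 0\<close>\<close>

text \<open>Multiplying the generating function for \<open>M + 1\<close> by
  \<open>1 - q^(M+1) t/u\<close> and \<open>1 - q^(M+1) t u\<close> leaves the one for
  \<open>M\<close> times the numerator factor \<open>1 + q^(M+1/2) t\<close>.\<close>

lemma trinom_rec_Suc:
  "trinom L (Suc M) a 0 = q ^ Suc M * (trinom (L - 1) (Suc M) (a + 1) 0 + trinom (L - 1) (Suc M) (a - 1) 0)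
     - q ^ (2 * Suc M) * trinom (L - 2) (Suc M) a 0
     + trinom L M a 0 + q_half ^ (2 * M + 1) * trinom (L - 1) M a 0"
proof -
  let ?N = "int (Suc M)"
  have N: "nat ?N = Suc M" "?N \<noteq> 0" "?N - 1 = int M" by simp_all
  have 1: "gen_trinom L a (Suc M) ?N ?N
    = q ^ Suc M * gen_trinom (L - 1) (a + 1) (Suc M) ?N ?N + gen_trinom L a (Suc M) (int M) ?N"
    using gen_trinom_pascal_left[of ?N L a "Suc M" ?N]
    by (simp add: N del: of_nat_Suc power_Suc)
  have 2: "gen_trinom L a (Suc M) (int M) ?N
    = q ^ Suc M * gen_trinom (L - 1) (a - 1) (Suc M) (int M) ?N + gen_trinom L a (Suc M) (int M) (int M)"
    using gen_trinom_pascal_right[of ?N a L "Suc M" "int M"]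
    by (simp add: N del: of_nat_Suc power_Suc)
  have 3: "gen_trinom (L - 1) (a - 1) (Suc M) ?N ?N
    = q ^ Suc M * gen_trinom (L - 2) a (Suc M) ?N ?N + gen_trinom (L - 1) (a - 1) (Suc M) (int M) ?N"
    using gen_trinom_pascal_left[of ?N "L - 1" "a - 1" "Suc M" ?N]
    by (simp add: N del: of_nat_Suc power_Suc)
  have Q: "q ^ (2 * Suc M) = q ^ Suc M * q ^ Suc M"
    by (simp only: mult_2 power_add)
  show ?thesis
    unfolding trinom_def add_0_right diff_zero Q 1 2 3 gen_trinom_Suc[of L a M "int M" "int M"]
    by (simp add: algebra_simps del: of_nat_Suc power_Suc)
qed

lemma trinom_0_right: "trinom L 0 a 0 = (if even (a + L) \<and> \<bar>a\<bar> \<le> L then 1 else 0)"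
proof -
  have "q_mchoose 0 k = (if 0 \<le> k then 1 else 0)" for k
    by simp
  moreover have "trinom L 0 a 0
    = (if even (a + L) then q_mchoose 0 ((L - a) div 2) * q_mchoose 0 ((L + a) div 2) else 0)"
    by (simp add: trinom_def gen_trinom_def trinom_weight_def q_binom_def q_poch_def)
  ultimately show ?thesis
    by (simp only:) (auto simp: abs_le_iff)
qed

text \<open>The generating function is \<open>1/((1 - t/u)(1 - t u))\<close>; clearing the
  denominator leaves 1, which has no term in \<open>t^L\<close> for \<open>L > 0\<close>.\<close>

lemma trinom_rec_0:
  assumes "L > 0"
  shows "trinom L 0 a 0 = trinom (L - 1) 0 (a + 1) 0 + trinom (L - 1) 0 (a - 1) 0 - trinom (L - 2) 0 a 0"
proof (cases "even (a + L)")
  case True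
  then have "\<bar>a\<bar> \<noteq> L - 1" by presburger
  then show ?thesis
    using True assms unfolding trinom_0_right by (auto simp: abs_if split: if_splits)
qed (auto simp: trinom_0_right)

text \<open>The recurrence of \<open>trinom_rec_Suc\<close>, inherited by the sums: it is applied to
  each summand, and \<open>power_mult_q_conv\<close> accounts for the powers of \<open>q\<close> in
  front.\<close>

lemma q_conv_trinom_rec:
  assumes "L > 0"
  defines "S \<equiv> \<lambda>L M a. q_conv L M (\<lambda>i. q_half ^ i\<^sup>2 * trinom (L - int i) i a 0)"
  shows "S L (Suc M) a = q ^ Suc M * (S (L - 1) (Suc M) (a + 1) + S (L - 1) (Suc M) (a - 1))
     - q ^ (2 * Suc M) * S (L - 2) (Suc M) a + S L M a + q_half ^ (2 * M + 1) * S (L - 1) M a"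
proof -
  define X where "X i = q_half ^ i\<^sup>2 * trinom (L - int i) i a 0" for i
  define W where "W i = q_half ^ i\<^sup>2 * trinom (L - 1 - int i) i a 0" for i
  define Y where "Y i = q_half ^ i\<^sup>2 * (trinom (L - 1 - int i) i (a + 1) 0
    + trinom (L - 1 - int i) i (a - 1) 0)" for i
  define Z where "Z i = q_half ^ i\<^sup>2 * trinom (L - 2 - int i) i a 0" for i
  \<comment> \<open>\<open>V j\<close> collects the last two terms of \<open>trinom_rec_Suc\<close>
    for the summand \<open>i = j + 1\<close>, with the factor
    \<open>q_half ^ (Suc j)\<^sup>2\<close> rewritten through that of index
    \<open>j\<close>.\<close>
  define V where "V i = q_half * q ^ i * W i + q * q ^ i * q ^ i * Z i" for i
  have X: "X i = q ^ i * Y i - q ^ i * q ^ i * Z i + shift V i" for i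
  proof (cases i)
    case 0
    then show ?thesis
      using trinom_rec_0[OF assms(1), of a] by (simp add: X_def Y_def Z_def)
  next
    case (Suc j)
    have P: "q_half ^ (Suc j)\<^sup>2 = q_half * q ^ j * q_half ^ j\<^sup>2"
      "q_half ^ (Suc j)\<^sup>2 * q_half ^ (2 * j + 1) = q * q ^ j * q ^ j * q_half ^ j\<^sup>2"
      unfolding q_def power_mult[symmetric] power_Suc[symmetric] power_add[symmetric]
      by (rule arg_cong[where f = "power q_half"], simp add: power2_eq_square)+
    have "q_half ^ (Suc j)\<^sup>2 * trinom (L - 1 - int j) j a 0 = q_half * q ^ j * W j"
      by (simp only: P(1) W_def mult.assoc)
    moreover have "q_half ^ (Suc j)\<^sup>2 * (q_half ^ (2 * j + 1) * trinom (L - 2 - int j) j a 0)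
      = q * q ^ j * q ^ j * Z j"
      by (simp only: P(2) Z_def mult.assoc[symmetric])
    moreover have "X i = q ^ i * Y i - q ^ i * q ^ i * Z i
      + q_half ^ (Suc j)\<^sup>2 * trinom (L - 1 - int j) j a 0
      + q_half ^ (Suc j)\<^sup>2 * (q_half ^ (2 * j + 1) * trinom (L - 2 - int j) j a 0)"
      unfolding X_def Y_def Z_def Suc mult_2[of "Suc j"] power_add trinom_rec_Suc[of "L - int (Suc j)" j a]
      by (simp add: algebra_simps del: power_Suc)
    ultimately show ?thesis
      by (simp add: V_def Suc)
  qed
  let ?N = "Suc M"
  let ?Q = "\<lambda>f i. q ^ i * f i"
  let ?D = "\<lambda>f i. q ^ i * f i - shift (?Q f) i"
  have "q ^ ?N * (S (L - 1) ?N (a + 1) + S (L - 1) ?N (a - 1)) = q ^ ?N * q_conv (L - 1) ?N Y"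
    by (simp add: S_def q_conv_add Y_def[abs_def] distrib_left)
  also have "\<dots> = q_conv L ?N (?D Y)"
    using assms by (intro power_mult_q_conv) auto
  finally have 1: "q ^ ?N * (S (L - 1) ?N (a + 1) + S (L - 1) ?N (a - 1)) = q_conv L ?N (?D Y)" .
  have "q ^ (2 * ?N) * S (L - 2) ?N a = q ^ ?N * (q ^ ?N * q_conv (L - 1 - 1) ?N Z)"
    unfolding mult_2 power_add by (simp add: S_def Z_def[abs_def] mult.assoc del: power_Suc)
  \<comment> \<open>Here \<open>L - 1\<close> may be 0; then \<open>Z\<close> vanishes, since its
    trinomial has a negative first argument.\<close>
  also have "q ^ ?N * q_conv (L - 1 - 1) ?N Z = q_conv (L - 1) ?N (?D Z)"
    by (intro power_mult_q_conv) (simp add: Z_def)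
  also have "q ^ ?N * \<dots> = q_conv L ?N (?D (?D Z))"
    using assms by (intro power_mult_q_conv) auto
  finally have 2: "q ^ (2 * ?N) * S (L - 2) ?N a = q_conv L ?N (?D (?D Z))" .
  have 3: "S L M a = q_conv L ?N (shift X)"
    by (simp add: S_def q_conv_shift_Suc X_def[abs_def])
  have half: "q_half ^ (2 * M + 1) = q_half * q ^ M"
    by (simp add: q_def power_mult)
  have "q_half ^ (2 * M + 1) * S (L - 1) M a = q_half * (q ^ M * q_conv (L - 1) M W)"
    unfolding half by (simp add: S_def W_def[abs_def] mult.assoc)
  also have "q ^ M * q_conv (L - 1) M W = q_conv L ?N (shift (?D W))"
    unfolding q_conv_shift_Suc using assms by (intro power_mult_q_conv) auto
  finally have 4: "q_half ^ (2 * M + 1) * S (L - 1) M a = q_conv L ?N (\<lambda>i. q_half * shift (?D W) i)"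
    by (simp add: q_conv_mult)
  have 5: "S L ?N a = q_conv L ?N X"
    by (simp add: S_def X_def[abs_def])
  \<comment> \<open>Relation \<open>X\<close> at \<open>i\<close> minus the same relation at
    \<open>i - 1\<close>. The \<open>Z\<close> part of \<open>V\<close> supplies the mixed terms of
    the double difference, which reaches back two indices.\<close>
  have "X i = ?D Y i - ?D (?D Z) i + shift X i + q_half * shift (?D W) i" for i
  proof (cases i)
    case 0
    then show ?thesis using X[of i] by simp
  next
    case (Suc j)
    then show ?thesis using X[of i] X[of j]
      by (cases j) (simp_all add: V_def algebra_simps)
  qed
  then have "q_conv L ?N X
     = q_conv L ?N (\<lambda>i. ?D Y i - ?D (?D Z) i + shift X i + q_half * shift (?D W) i)"
    by (intro arg_cong[where f = "q_conv L ?N"] ext)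
  then show ?thesis
    unfolding 1 2 3 4 5 q_conv_add q_conv_diff .
qed

lemma q_conv_trinom_0:
  "q_conv L M (\<lambda>i. q_half ^ i\<^sup>2 * trinom (L - int i) i a 0) = trinom L M a 0"
proof (induction M arbitrary: L a)
  case 0
  show ?case by (cases "L < 0") (simp_all add: q_conv_def)
next
  case (Suc M)
  note IH = Suc.IH
  show ?case
  proof (induction "nat L" arbitrary: L a rule: less_induct)
    case less
    consider "L < 0" | "L = 0" | "L > 0" by linarith
    then show ?case
    proof cases
      case 2
      \<comment> \<open>The recurrence for the sums needs \<open>L > 0\<close>. At
        \<open>L = 0\<close> only the summand \<open>i = 0\<close> survives, and the trinomial is
        independent of \<open>M\<close>.\<close>
      have "q_conv 0 K (\<lambda>i. q_half ^ i\<^sup>2 * trinom (0 - int i) i a 0) = trinom 0 0 a 0" for K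
        unfolding q_conv_def by (subst sum.atMost_shift) simp
      moreover have "trinom 0 K a 0 = trinom 0 0 a 0" for K
        by (induction K) (simp_all add: trinom_rec_Suc[of 0])
      ultimately show ?thesis using 2 by metis
    next
      case 3
      have "nat (L - 2) < nat L" "nat (L - 1) < nat L" using 3 by auto
      then show ?thesis
        unfolding q_conv_trinom_rec[OF 3] trinom_rec_Suc[of L] by (simp only: less IH)
    qed simp
  qed
qed

section \<open>The step from \<open>b\<close> to \<open>b + 1\<close>\<close>

text \<open>For \<open>b \<le> m\<close> both sides reduce to
  \<open>G (a - 1) + q^(b+1/2) G a\<close> with
  \<open>G e = gen_trinom L e m (m + b + 1) (m - b)\<close>; the terms in \<open>L - 1\<close>
  cancel. This is what the summand \<open>i = m + 1\<close> of \<open>q_conv_shift_b\<close>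
  requires.\<close>

lemma trinom_shift_b_mixed:
  assumes "a > 0"
  shows "trinom L (Suc m) (a - 1) (int (Suc b))
      - q_half ^ (2 * b + 2) * q ^ Suc m * trinom (L - 1) (Suc m) a (int (Suc b))
      + q_half ^ (2 * b + 1) * trinom L m a (int (Suc b))
    = q_half ^ (2 * b + 1) * trinom L (Suc m) a (int b)
      - q_half * q ^ Suc m * trinom (L - 1) (Suc m) (a - 1) (int b) + trinom L m (a - 1) (int b)"
proof -
  consider "b \<le> m" | "b = Suc m" | "b > Suc m" by linarith
  then show ?thesis
  proof cases
    case 1
    then obtain d where m: "m = b + d" by (auto simp: le_iff_add)
    define N where "N = int (m + b + 1)"
    define K where "K = int d"
    have 1: "gen_trinom L (a - 1) (Suc m) (N + 1) K
      = q ^ (m + b + 2) * gen_trinom (L - 1) a (Suc m) (N + 1) K + gen_trinom L (a - 1) (Suc m) N K"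
      using gen_trinom_pascal_left[of "N + 1" L "a - 1" "Suc m" K]
      by (simp add: N_def nat_add_distrib)
    \<comment> \<open>For \<open>d = 0\<close> the last index drops from 0 to -1, and the step rests
      on \<open>a > 0\<close>.\<close>
    have 2: "gen_trinom L a m N (K - 1) = gen_trinom L a m N K - q ^ d * gen_trinom (L - 1) (a - 1) m N K"
      using gen_trinom_pascal_right[of K a L m N] assms by (simp add: K_def)
    have 3: "gen_trinom L a (Suc m) N (K + 1)
      = q ^ Suc d * gen_trinom (L - 1) (a - 1) (Suc m) N (K + 1) + gen_trinom L a (Suc m) N K"
      using gen_trinom_pascal_right[of "K + 1" a L "Suc m" N] assms by (simp add: K_def nat_add_distrib)
    have 4: "gen_trinom L (a - 1) m (N - 1) K
      = gen_trinom L (a - 1) m N K - q ^ (m + b + 1) * gen_trinom (L - 1) a m N K"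
      using gen_trinom_pascal_left[of N L "a - 1" m K] by (simp add: N_def nat_add_distrib)
    have T: "trinom L (Suc m) c (int (Suc b)) = gen_trinom L c (Suc m) (N + 1) K"
      "trinom L m c (int (Suc b)) = gen_trinom L c m N (K - 1)"
      "trinom L (Suc m) c (int b) = gen_trinom L c (Suc m) N (K + 1)"
      "trinom L m c (int b) = gen_trinom L c m (N - 1) K" for L c
      by (simp_all add: trinom_def N_def K_def m algebra_simps)
    have P: "q_half ^ (2 * b + 2) * q ^ Suc m = q ^ (m + b + 2)"
      "q_half * q ^ Suc m = q_half ^ (2 * b + 1) * q ^ Suc d"
      "q_half ^ (2 * m + 1) = q_half ^ (2 * b + 1) * q ^ d"
      "q ^ (m + b + 1) = q_half ^ (2 * b + 1) * q_half ^ (2 * m + 1)"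
      unfolding q_def power_mult[symmetric] power_Suc[symmetric] power_add[symmetric]
      by (rule arg_cong[where f = "power q_half"], simp add: m)+
    show ?thesis
      unfolding T P(1,2) 1 2 3 4 gen_trinom_Suc[of L "a - 1" m N K] gen_trinom_Suc[of L a m N K] P(4) P(3)
      by (simp add: algebra_simps del: power_Suc)
  next
    case 2
    have "trinom L b a (int b) = trinom (L - 1) b (a - 1) (int b)"
      using gen_trinom_pascal_right[of 0 a L b "int b + int b"] assms by (simp add: trinom_def)
    moreover have "q_half * q ^ b = q_half ^ (2 * b + 1)"
      by (simp add: q_def power_mult)
    ultimately show ?thesis using 2 by (simp del: power_Suc)
  qed simp
qed

text \<open>Once \<open>power_mult_q_conv\<close> has absorbed \<open>q ^ M\<close>, the identity
  holds summand by summand.\<close>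

lemma q_conv_shift_b:
  fixes M :: nat
  assumes "a > 0"
  defines "S \<equiv> \<lambda>L a b. q_conv L M (\<lambda>i. q_half ^ i\<^sup>2 * trinom (L - int i) i a (int b))"
  shows "S L (a - 1) (Suc b) - q_half ^ (2 * b + 2) * q ^ M * S (L - 1) a (Suc b)
    = q_half ^ (2 * b + 1) * S L a b - q_half * q ^ M * S (L - 1) (a - 1) b"
proof -
  define X where "X L a b i = q_half ^ i\<^sup>2 * trinom (L - int i) i a (int b)" for L a b i
  let ?D = "\<lambda>f i. q ^ i * f i - shift (\<lambda>i. q ^ i * f i) i"
  have S: "S L a b = q_conv L M (X L a b)" for L a b
    by (simp add: S_def X_def[abs_def])
  have D: "q ^ M * q_conv (L - 1) M (X (L - 1) a b) = q_conv L M (?D (X (L - 1) a b))" for a b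
    by (intro power_mult_q_conv) (simp add: X_def)
  have "X L (a - 1) (Suc b) i - q_half ^ (2 * b + 2) * ?D (X (L - 1) a (Suc b)) i
     = q_half ^ (2 * b + 1) * X L a b i - q_half * ?D (X (L - 1) (a - 1) b) i" for i
  proof (cases i)
    case 0
    have "trinom L 0 a 0 = trinom (L - 1) 0 (a - 1) 0"
      using gen_trinom_pascal_right[of 0 a L 0 0] assms by (simp add: trinom_def)
    then show ?thesis
      by (cases "b = 0") (simp_all add: 0 X_def)
  next
    case (Suc m)
    have P: "q_half ^ (2 * b + 2) * q ^ m * q_half ^ m\<^sup>2 = q_half ^ (Suc m)\<^sup>2 * q_half ^ (2 * b + 1)"
      "q_half * q ^ m * q_half ^ m\<^sup>2 = q_half ^ (Suc m)\<^sup>2"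
      unfolding q_def power_mult[symmetric] power_Suc[symmetric] power_add[symmetric]
      by (rule arg_cong[where f = "power q_half"], simp add: power2_eq_square)+
    \<comment> \<open>Here \<open>w\<close> and \<open>v\<close> stand for
      \<open>q_half ^ i\<^sup>2\<close> at \<open>i = m + 1\<close> and \<open>i = m\<close>, and
      \<open>z\<close> and \<open>y\<close> for \<open>q ^ i\<close> at the same two places.\<close>
    have eq: "w * t\<^sub>1 - d * (z * (w * t\<^sub>2) - y * (v * t\<^sub>3)) = c * (w * t\<^sub>4) - h * (z * (w * t\<^sub>5) - y * (v * t\<^sub>6))"
      if "t\<^sub>1 - d * z * t\<^sub>2 + c * t\<^sub>3 = c * t\<^sub>4 - h * z * t\<^sub>5 + t\<^sub>6" "d * y * v = w * c" "h * y * v = w"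
      for w t\<^sub>1 t\<^sub>2 t\<^sub>3 t\<^sub>4 t\<^sub>5 t\<^sub>6 c d h v y z :: "int poly"
    proof -
      have "w * t\<^sub>1 - d * (z * (w * t\<^sub>2) - y * (v * t\<^sub>3)) = w * (t\<^sub>1 - d * z * t\<^sub>2) + (d * y * v) * t\<^sub>3"
        by (simp add: algebra_simps)
      also have "\<dots> = w * (t\<^sub>1 - d * z * t\<^sub>2 + c * t\<^sub>3)"
        unfolding that(2) by (simp add: algebra_simps)
      also have "\<dots> = w * (c * t\<^sub>4 - h * z * t\<^sub>5) + (h * y * v) * t\<^sub>6"
        unfolding that(1,3) by (simp add: algebra_simps)
      also have "\<dots> = c * (w * t\<^sub>4) - h * (z * (w * t\<^sub>5) - y * (v * t\<^sub>6))"
        by (simp add: algebra_simps)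
      finally show ?thesis .
    qed
    have L: "L - 1 - int m = L - int (Suc m)" "L - 1 - int (Suc m) = L - int (Suc m) - 1"
      by simp_all
    show ?thesis
      unfolding Suc X_def shift_simps L
      using trinom_shift_b_mixed[OF assms(1), of "L - int (Suc m)" m b] P
      by (rule eq)
  qed
  then show ?thesis
    unfolding S mult.assoc D by (simp add: q_conv_mult q_conv_diff)
qed

text \<open>Both sides are \<open>q^(b+1/2)\<close> times
  \<open>gen_trinom L (a + b) M (M + b) (M - b - 1)\<close>: on the left a factor of the first
  denominator is removed, on the right one of the second. Up to the factor \<open>q^(b^2/2)\<close>
  this is the recurrence of \<open>q_conv_shift_b\<close> for the right side of the theorem.\<close>

lemma trinom_shift_b:
  assumes "a > 0"
  shows "q_half ^ (2 * b + 1) * (trinom L M (a + int b) (int (Suc b))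
      - q_half ^ (2 * b + 2) * q ^ M * trinom (L - 1) M (a + int (Suc b)) (int (Suc b)))
    = q_half ^ (2 * b + 1) * trinom L M (a + int b) (int b)
      - q_half * q ^ M * trinom (L - 1) M (a - 1 + int b) (int b)"
proof (cases "b \<le> M")
  case True
  then obtain d where M: "M = b + d" by (auto simp: le_iff_add)
  define N K c where "N = int (M + b)" and "K = int d" and "c = a + int b"
  have 1: "gen_trinom L c M (N + 1) (K - 1)
    = q ^ (M + b + 1) * gen_trinom (L - 1) (c + 1) M (N + 1) (K - 1) + gen_trinom L c M N (K - 1)"
    using gen_trinom_pascal_left[of "N + 1" L c M "K - 1"] by (simp add: N_def nat_add_distrib)
  have 2: "gen_trinom L c M N K
    = q ^ d * gen_trinom (L - 1) (c - 1) M N K + gen_trinom L c M N (K - 1)"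
    using gen_trinom_pascal_right[of K c L M N] assms by (simp add: K_def c_def)
  have T: "trinom L M e (int (Suc b)) = gen_trinom L e M (N + 1) (K - 1)"
    "trinom L M e (int b) = gen_trinom L e M N K" for L e
    by (simp_all add: trinom_def N_def K_def M algebra_simps)
  have P: "q_half ^ (2 * b + 2) * q ^ M = q ^ (M + b + 1)"
    "q_half * q ^ M = q_half ^ (2 * b + 1) * q ^ d"
    unfolding q_def power_mult[symmetric] power_Suc[symmetric] power_add[symmetric]
    by (rule arg_cong[where f = "power q_half"], simp add: M)+
  have c: "a + int b = c" "a + int (Suc b) = c + 1" "a - 1 + int b = c - 1"
    by (simp_all add: c_def)
  show ?thesis
    unfolding T P c 1 2 by (simp add: algebra_simps del: power_Suc)
qed simp

text \<open>The two recurrences agree at \<open>a + 1 > 0\<close>. They lead from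
  \<open>(L, a, b + 1)\<close> to \<open>(L - 1, a + 1, b + 1)\<close>, so the inner induction on
  \<open>L\<close> keeps \<open>a\<close> arbitrary.\<close>

lemma q_conv_trinom:
  assumes "a \<ge> 0"
  shows "q_conv L M (\<lambda>i. q_half ^ i\<^sup>2 * trinom (L - int i) i a (int b))
    = q_half ^ b\<^sup>2 * trinom L M (a + int b) (int b)"
  using assms
proof (induction b arbitrary: L a)
  case 0
  show ?case using q_conv_trinom_0 by simp
next
  case (Suc b)
  note IH = Suc.IH
  from Suc.prems show ?case
  proof (induction "nat L" arbitrary: L a rule: less_induct)
    case less
    show ?case
    proof (cases "L < 0")
      case False
      let ?S = "\<lambda>L a b. q_conv L M (\<lambda>i. q_half ^ i\<^sup>2 * trinom (L - int i) i a (int b))"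
      have 1: "?S (L - 1) (a + 1) (Suc b)
        = q_half ^ (Suc b)\<^sup>2 * trinom (L - 1) M (a + 1 + int (Suc b)) (int (Suc b))"
      proof (cases "L = 0")
        case False
        then show ?thesis using less \<open>\<not> L < 0\<close> by simp
      qed simp
      have 2: "?S L (a + 1) b = q_half ^ b\<^sup>2 * trinom L M (a + 1 + int b) (int b)"
        "?S (L - 1) a b = q_half ^ b\<^sup>2 * trinom (L - 1) M (a + int b) (int b)"
        using IH less.prems by auto
      have P: "q_half ^ (Suc b)\<^sup>2 = q_half ^ b\<^sup>2 * q_half ^ (2 * b + 1)"
        unfolding power_add[symmetric]
        by (rule arg_cong[where f = "power q_half"]) (simp add: power2_eq_square)
      have a: "a + 1 - 1 = a" "a + 1 + int b = a + int (Suc b)" by simp_all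
      have "a + 1 > 0" using less.prems by simp
      have eq: "s = w * c * t" if "s - d * (w * c * t') = c * (w * u) - e * (w * v)"
        "c * (t - d * t') = c * u - e * v" for s w c t d t' u e v :: "int poly"
      proof -
        have "s = d * (w * c * t') + w * (c * u - e * v)"
          using that(1) by (simp add: algebra_simps)
        also have "\<dots> = w * c * t"
          unfolding that(2)[symmetric] by (simp add: algebra_simps)
        finally show ?thesis .
      qed
      show ?thesis
        using q_conv_shift_b[OF \<open>a + 1 > 0\<close>, of L M b] trinom_shift_b[OF \<open>a + 1 > 0\<close>, of b L M]
        unfolding 1 2 P a by (rule eq)
    qed simp
  qed
qed

section \<open>Back to the sum of the theorem\<close>

lemma sum_eq_q_conv:
  "(\<Sum>i = \<bar>b\<bar>..min (L - \<bar>a\<bar>) (int M).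
      q_half ^ nat (i\<^sup>2) * q_binom (L + int M - i) L * q_trinom (L - i) i a b)
   = q_conv L M (\<lambda>i. q_half ^ i\<^sup>2 * trinom (L - int i) i a b)"
proof -
  let ?f = "\<lambda>i. q_half ^ nat (i\<^sup>2) * q_binom (L + int M - i) L * q_trinom (L - i) i a b"
  have "sum ?f {\<bar>b\<bar>..min (L - \<bar>a\<bar>) (int M)} = sum ?f {0..int M}"
  proof (intro sum.mono_neutral_left ballI)
    fix i assume i: "i \<in> {0..int M} - {\<bar>b\<bar>..min (L - \<bar>a\<bar>) (int M)}"
    then have "i < \<bar>b\<bar> \<or> L - i < \<bar>a\<bar>" by auto
    then have "q_trinom (L - i) i a b = 0"
    proof
      assume "i < \<bar>b\<bar>"
      then show ?thesis using trinom_eq[of "L - i" "nat i" a b] i by simp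
    next
      assume "L - i < \<bar>a\<bar>"
      then show ?thesis by (auto simp: q_trinom_def intro: sum.neutral)
    qed
    then show "?f i = 0" by simp
  qed auto
  also have "{0..int M} = int ` {..M}"
    by (simp add: atMost_atLeast0 image_int_atLeastAtMost)
  also have "sum ?f \<dots> = q_conv L M (\<lambda>i. q_half ^ i\<^sup>2 * trinom (L - int i) i a b)"
    unfolding q_conv_def
    by (subst sum.reindex)
      (auto simp: q_mchoose_def trinom_eq nat_power_eq algebra_simps intro!: sum.cong)
  finally show ?thesis .
qed

theorem theorem3p1:
  fixes L M a b :: int
  assumes "(a \<ge> 0 \<and> b \<ge> 0) \<or> (a \<le> 0 \<and> b \<le> 0)"
  shows "(\<Sum>i = \<bar>b\<bar>..min (L - \<bar>a\<bar>) M.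
            q_half ^ nat (i\<^sup>2) * q_binom (L + M - i) L * q_trinom (L - i) i a b)
         = q_half ^ nat (b\<^sup>2) * q_trinom L M (a + b) b"
proof (cases "M < 0")
  case True
  then show ?thesis by (simp add: q_trinom_def)
next
  case False
  then obtain m where M: "M = int m" by (metis not_less zero_le_imp_eq_int)
  define c where "c = nat \<bar>b\<bar>"
  have c: "nat (b\<^sup>2) = c\<^sup>2" "int c = \<bar>b\<bar>"
    by (simp_all add: c_def nat_power_eq[symmetric])
  \<comment> \<open>As \<open>a\<close> and \<open>b\<close> do not have opposite signs, passing to
    absolute values either changes nothing or negates both arguments.\<close>
  have "trinom L m \<bar>a\<bar> \<bar>b\<bar> = trinom L m a b" "trinom L m (\<bar>a\<bar> + \<bar>b\<bar>) \<bar>b\<bar> = trinom L m (a + b) b"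
    for L m
    using assms trinom_uminus[of L m a b] trinom_uminus[of L m "a + b" b] by (auto simp: abs_if)
  then show ?thesis
    using q_conv_trinom[of "\<bar>a\<bar>" L m c] unfolding M sum_eq_q_conv trinom_eq c by simp
qed

end
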